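(* Let $G$ be a complex reflection group acting on $V\cong\mathbb{C}^2$. The codimension atoms of $G$ are exactly the reflections in $G$ together with the elements $g\in G$ such that $\ell(g)>\operatorname{codim}(g)$.
   Context: A reflection is an element of $GL(V)$ of finite order fixing a hyperplane pointwise; a complex reflection group is a finite subgroup of $GL(V)$ generated by reflections. $\ell(g)$ is the minimal number of reflections in $G$ whose product is $g$ ($\ell(1)=0$), and $\operatorname{codim}(g)=2-\dim\{v\in V:gv=v\}$. The codimension order is $a\le_\perp c$ iff $\operatorname{codim}(a)+\operatorname{codim}(a^{-1}c)=\operatorname{codim}(c)$, and a codimension atom is an element covering the identity in this poset. *)

theory Defs
  imports "HOL-Analysis.Analysis"
begin

type_synonym cmat = "complex^2^2"

text \<open>Fixed space of g acting on V = complex^2, and its complex dimension.\<close>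
definition fixed_space :: "cmat \<Rightarrow> (complex^2) set" where
  "fixed_space g = {v. g *v v = v}"

definition codim :: "cmat \<Rightarrow> nat" where
  "codim g = 2 - vec.dim (fixed_space g)"

text \<open>A reflection: element of GL(V) of finite order, not the identity,
  fixing a hyperplane (complex 1-dimensional subspace) pointwise.\<close>
definition is_reflection :: "cmat \<Rightarrow> bool" where
  "is_reflection g \<longleftrightarrow> invertible g \<and> g \<noteq> mat 1 \<and>
     (\<exists>n>0. (((**) g) ^^ n) (mat 1) = mat 1) \<and>
     (\<exists>H. vec.subspace H \<and> vec.dim H = 1 \<and> (\<forall>v\<in>H. g *v v = v))"

text \<open>Subgroup of GL(V) generated by a set of matrices.\<close>
inductive_set gen_group :: "cmat set \<Rightarrow> cmat set" for S where
  one: "mat 1 \<in> gen_group S"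
| gen: "s \<in> S \<Longrightarrow> s \<in> gen_group S"
| mult: "a \<in> gen_group S \<Longrightarrow> b \<in> gen_group S \<Longrightarrow> a ** b \<in> gen_group S"
| inv: "a \<in> gen_group S \<Longrightarrow> matrix_inv a \<in> gen_group S"

definition complex_reflection_group :: "cmat set \<Rightarrow> bool" where
  "complex_reflection_group G \<longleftrightarrow> finite G \<and>
     (\<exists>R. (\<forall>r\<in>R. is_reflection r) \<and> G = gen_group R)"

text \<open>Reflection length: minimal number of reflections in G with product g.\<close>
definition refl_length :: "cmat set \<Rightarrow> cmat \<Rightarrow> nat" where
  "refl_length G g = (LEAST k. \<exists>rs. length rs = k \<and>
       (\<forall>r\<in>set rs. r \<in> G \<and> is_reflection r) \<and> foldr (**) rs (mat 1) = g)"

definition codim_le :: "cmat \<Rightarrow> cmat \<Rightarrow> bool" where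
  "codim_le a c \<longleftrightarrow> codim a + codim (matrix_inv a ** c) = codim c"

text \<open>Codimension atom: covers the identity in the poset (G, codim_le).\<close>
definition codim_atom :: "cmat set \<Rightarrow> cmat \<Rightarrow> bool" where
  "codim_atom G g \<longleftrightarrow> g \<in> G \<and> g \<noteq> mat 1 \<and> codim_le (mat 1) g \<and>
     \<not> (\<exists>c\<in>G. c \<noteq> mat 1 \<and> c \<noteq> g \<and> codim_le (mat 1) c \<and> codim_le c g)"

end

theory Submission
  imports Defs
begin

text \<open>In dimension 2 the codimension takes only the values 0, 1, 2, and it is 0 exactly at the
  identity. Hence a proper intermediate element \<open>1 < c < g\<close> of the codimension order can only
  exist when \<open>codim g = 2\<close>, and then \<open>c\<close> and \<open>c\<inverse>g\<close> both have codimension 1, i.e.\ are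
  reflections of \<open>G\<close>. So elements of codimension 1 (the reflections) are atoms, and an element
  of codimension 2 is an atom iff it is not a product of two reflections, i.e.\ iff
  \<open>\<ell>(g) > 2\<close>.\<close>

lemma
  fixes A :: "'a::semiring_1^'n^'n"
  assumes "invertible A"
  shows matrix_mul_matrix_inv: "A ** matrix_inv A = mat 1"
    and matrix_inv_matrix_mul: "matrix_inv A ** A = mat 1"
proof -
  have "\<exists>A'. A ** A' = mat 1 \<and> A' ** A = mat 1"
    using assms unfolding invertible_def by blast
  then have "A ** matrix_inv A = mat 1 \<and> matrix_inv A ** A = mat 1"
    unfolding matrix_inv_def by (rule someI_ex)
  then show "A ** matrix_inv A = mat 1" "matrix_inv A ** A = mat 1" by auto
qed

lemma invertible_matrix_inv:
  fixes A :: "'a::semiring_1^'n^'n"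
  shows "invertible A \<Longrightarrow> invertible (matrix_inv A)"
  using matrix_mul_matrix_inv matrix_inv_matrix_mul unfolding invertible_def by blast

lemma matrix_inv_unique:
  fixes A B :: "'a::semiring_1^'n^'n"
  assumes "invertible A" "B ** A = mat 1"
  shows "matrix_inv A = B"
proof -
  have "matrix_inv A = (B ** A) ** matrix_inv A" using assms(2) by simp
  also have "\<dots> = B" by (simp add: matrix_mul_assoc[symmetric] matrix_mul_matrix_inv[OF assms(1)])
  finally show ?thesis .
qed

lemma invertible_mat_1: "invertible (mat 1 :: 'a::semiring_1^'n^'n)"
  unfolding invertible_def by (rule exI[of _ "mat 1"]) simp

lemma matrix_inv_mat_1: "matrix_inv (mat 1 :: 'a::semiring_1^'n^'n) = mat 1"
  using matrix_inv_matrix_mul[OF invertible_mat_1] by simp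

lemma matrix_mul_matrix_inv_cancel_left:
  fixes A B :: "'a::semiring_1^'n^'n"
  shows "invertible A \<Longrightarrow> A ** (matrix_inv A ** B) = B"
  by (simp add: matrix_mul_assoc matrix_mul_matrix_inv)

lemma foldr_matrix_mul: "foldr (**) xs B = foldr (**) xs (mat 1) ** B"
  by (induction xs) (simp_all add: matrix_mul_assoc)

lemma matrix_inv_foldr:
  fixes rs :: "('a::semiring_1^'n^'n) list"
  assumes "\<forall>r\<in>set rs. invertible r"
  shows "foldr (**) (rev (map matrix_inv rs)) (mat 1) ** foldr (**) rs (mat 1) = mat 1"
  using assms
proof (induction rs)
  case Nil
  then show ?case by simp
next
  case (Cons r rs)
  have "foldr (**) (rev (map matrix_inv (r # rs))) (mat 1) ** foldr (**) (r # rs) (mat 1)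
     = foldr (**) (rev (map matrix_inv rs)) (mat 1) ** (matrix_inv r ** r) ** foldr (**) rs (mat 1)"
    using foldr_matrix_mul[of "rev (map matrix_inv rs)" "matrix_inv r"]
    by (simp add: matrix_mul_assoc)
  also have "\<dots> = mat 1" using Cons by (simp add: matrix_inv_matrix_mul)
  finally show ?case .
qed

subsection \<open>Codimension in dimension 2\<close>

lemma subspace_fixed_space: "vec.subspace (fixed_space g)"
  unfolding fixed_space_def vec.subspace_def
  by (auto simp: matrix_vector_right_distrib vector_scalar_commute matrix_vector_mult_0_right)

lemma dim_UNIV_complex_2: "vec.dim (UNIV :: (complex^2) set) = 2"
  by (rule trans[OF vec_dim_card]) simp

lemma dim_fixed_space_le: "vec.dim (fixed_space g) \<le> 2"
  using vec.dim_subset[of "fixed_space g" UNIV] dim_UNIV_complex_2 by simp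

lemma codim_le_2: "codim g \<le> 2"
  unfolding codim_def by simp

lemma codim_eq_0_iff: "codim g = 0 \<longleftrightarrow> g = mat 1"
proof
  assume "codim g = 0"
  then have "vec.dim (fixed_space g) = vec.dim (UNIV :: (complex^2) set)"
    using dim_fixed_space_le[of g] dim_UNIV_complex_2 unfolding codim_def by simp
  then have "fixed_space g = UNIV"
    using vec.subspace_dim_equal[OF subspace_fixed_space vec.subspace_UNIV] by simp
  then show "g = mat 1" unfolding fixed_space_def by (auto simp: matrix_eq)
next
  assume "g = mat 1"
  then have "fixed_space g = UNIV" unfolding fixed_space_def by auto
  then show "codim g = 0" unfolding codim_def using dim_UNIV_complex_2 by simp
qed

lemma codim_mat_1 [simp]: "codim (mat 1) = 0"
  using codim_eq_0_iff by blast

lemma codim_reflection: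
  assumes "is_reflection g"
  shows "codim g = 1"
proof -
  obtain H where H: "vec.dim H = 1" "\<forall>v\<in>H. g *v v = v"
    using assms unfolding is_reflection_def by blast
  then have "H \<subseteq> fixed_space g" unfolding fixed_space_def by auto
  then have "1 \<le> vec.dim (fixed_space g)" using vec.dim_subset H(1) by metis
  moreover have "codim g \<noteq> 0"
    using assms unfolding is_reflection_def by (simp add: codim_eq_0_iff)
  ultimately show ?thesis using dim_fixed_space_le[of g] unfolding codim_def by linarith
qed

lemma is_reflection_if_codim_eq_1:
  assumes "invertible g" "\<exists>n>0. ((**) g ^^ n) (mat 1) = mat 1" "codim g = 1"
  shows "is_reflection g"
  unfolding is_reflection_def
proof (intro conjI assms(1,2) exI[of _ "fixed_space g"])
  show "g \<noteq> mat 1" using assms(3) by (metis codim_eq_0_iff zero_neq_one)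
  show "vec.dim (fixed_space g) = 1"
    using assms(3) dim_fixed_space_le[of g] unfolding codim_def by linarith
qed (use subspace_fixed_space in \<open>auto simp: fixed_space_def\<close>)

lemma codim_le_mat_1: "codim_le (mat 1) c"
  unfolding codim_le_def by (simp add: codim_eq_0_iff matrix_inv_mat_1)

lemma codim_le_proper:
  assumes "invertible c" "c \<noteq> mat 1" "c \<noteq> g" "codim_le c g"
  shows "codim c = 1" "codim (matrix_inv c ** g) = 1" "codim g = 2"
proof -
  have "matrix_inv c ** g \<noteq> mat 1"
    using matrix_mul_matrix_inv_cancel_left[OF assms(1), of g] assms(3) by auto
  then have "codim (matrix_inv c ** g) \<noteq> 0" "codim c \<noteq> 0"
    using assms(2) codim_eq_0_iff by auto
  then show "codim c = 1" "codim (matrix_inv c ** g) = 1" "codim g = 2"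
    using assms(4) codim_le_2[of g] unfolding codim_le_def by linarith+
qed

subsection \<open>Reflections and the groups they generate\<close>

lemma matrix_funpow_add:
  fixes g :: "'a::semiring_1^'n^'n"
  shows "((**) g ^^ (a + b)) (mat 1) = ((**) g ^^ a) (mat 1) ** ((**) g ^^ b) (mat 1)"
  by (induction a) (simp_all add: matrix_mul_assoc)

lemma invertible_matrix_funpow:
  fixes g :: "'a::semiring_1^'n^'n"
  shows "invertible g \<Longrightarrow> invertible (((**) g ^^ n) (mat 1))"
  by (induction n) (simp_all add: invertible_mat_1 invertible_mult)

lemma matrix_inv_funpow_mul_funpow:
  fixes g :: "'a::semiring_1^'n^'n"
  assumes "invertible g"
  shows "((**) (matrix_inv g) ^^ n) (mat 1) ** ((**) g ^^ n) (mat 1) = mat 1"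
proof (induction n)
  case 0
  then show ?case by simp
next
  case (Suc n)
  have "((**) g ^^ Suc n) (mat 1) = ((**) g ^^ n) (mat 1) ** g"
    using matrix_funpow_add[where g = g and a = n and b = 1] by simp
  then have "((**) (matrix_inv g) ^^ Suc n) (mat 1) ** ((**) g ^^ Suc n) (mat 1)
      = matrix_inv g ** (((**) (matrix_inv g) ^^ n) (mat 1) ** ((**) g ^^ n) (mat 1)) ** g"
    by (simp add: matrix_mul_assoc)
  then show ?case using Suc matrix_inv_matrix_mul[OF assms] by simp
qed

lemma finite_order_if_finite_powers:
  fixes g :: "'a::semiring_1^'n^'n"
  assumes "invertible g" "finite (range (\<lambda>n. ((**) g ^^ n) (mat 1)))"
  shows "\<exists>n>0. ((**) g ^^ n) (mat 1) = mat 1"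
proof -
  let ?pow = "\<lambda>n. ((**) g ^^ n) (mat 1)"
  have "\<not> inj ?pow" using assms(2) finite_imageD infinite_UNIV_nat by blast
  then obtain a b where ab: "a < b" "?pow a = ?pow b"
    unfolding inj_def by (metis linorder_neqE_nat)
  have "?pow (b - a) ** ?pow a = ?pow a"
    using matrix_funpow_add[where g = g and a = "b - a" and b = a] ab by simp
  then have "?pow (b - a) ** (?pow a ** matrix_inv (?pow a)) = ?pow a ** matrix_inv (?pow a)"
    by (simp add: matrix_mul_assoc)
  then have "?pow (b - a) = mat 1"
    using matrix_mul_matrix_inv[OF invertible_matrix_funpow[OF assms(1)]] by simp
  then show ?thesis using ab(1) by (intro exI[of _ "b - a"]) simp
qed

lemma is_reflection_matrix_inv:
  assumes "is_reflection r"
  shows "is_reflection (matrix_inv r)"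
proof -
  obtain n H where r: "invertible r" "r \<noteq> mat 1" "n > 0" "((**) r ^^ n) (mat 1) = mat 1"
    and H: "vec.subspace H" "vec.dim H = 1" "\<forall>v\<in>H. r *v v = v"
    using assms unfolding is_reflection_def by blast
  have "matrix_inv r \<noteq> mat 1"
    using matrix_mul_matrix_inv[OF r(1)] r(2) by auto
  moreover have "((**) (matrix_inv r) ^^ n) (mat 1) = mat 1"
    using matrix_inv_funpow_mul_funpow[OF r(1), of n] r(4) by simp
  moreover have "matrix_inv r *v v = v" if "v \<in> H" for v
    using H(3) that matrix_inv_matrix_mul[OF r(1)] by (metis matrix_vector_mul_assoc matrix_vector_mul_lid)
  ultimately show ?thesis
    unfolding is_reflection_def using invertible_matrix_inv[OF r(1)] r(3) H(1,2) by blast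
qed

lemma invertible_gen_group:
  assumes "\<forall>s\<in>S. invertible s"
  shows "a \<in> gen_group S \<Longrightarrow> invertible a"
  by (induction rule: gen_group.induct)
    (use assms in \<open>auto simp: invertible_mat_1 invertible_mult invertible_matrix_inv\<close>)

lemma funpow_in_gen_group: "g \<in> gen_group S \<Longrightarrow> ((**) g ^^ n) (mat 1) \<in> gen_group S"
  by (induction n) (auto intro: gen_group.intros)

lemma gen_group_reflection_word:
  assumes "\<forall>r\<in>R. is_reflection r"
  shows "a \<in> gen_group R \<Longrightarrow> \<exists>rs. (\<forall>r\<in>set rs. r \<in> gen_group R \<and> is_reflection r) \<and>
    foldr (**) rs (mat 1) = a"
proof (induction rule: gen_group.induct)
  case one
  then show ?case by (intro exI[of _ "[]"]) simp
next
  case (gen s)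
  then show ?case using assms by (intro exI[of _ "[s]"]) (auto intro: gen_group.gen)
next
  case (mult a b)
  then obtain xs ys where
    xs: "\<forall>r\<in>set xs. r \<in> gen_group R \<and> is_reflection r" "foldr (**) xs (mat 1) = a" and
    ys: "\<forall>r\<in>set ys. r \<in> gen_group R \<and> is_reflection r" "foldr (**) ys (mat 1) = b"
    by blast
  then show ?case using foldr_matrix_mul[of xs b] by (intro exI[of _ "xs @ ys"]) auto
next
  case (inv a)
  then obtain xs where
    xs: "\<forall>r\<in>set xs. r \<in> gen_group R \<and> is_reflection r" "foldr (**) xs (mat 1) = a"
    by blast
  then have "\<forall>r\<in>set xs. invertible r" unfolding is_reflection_def by blast
  then have "matrix_inv a = foldr (**) (rev (map matrix_inv xs)) (mat 1)"
    using matrix_inv_unique matrix_inv_foldr xs(2) assms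
      invertible_gen_group[OF _ inv.hyps] unfolding is_reflection_def by metis
  moreover have "\<forall>r\<in>set (rev (map matrix_inv xs)). r \<in> gen_group R \<and> is_reflection r"
    using xs(1) is_reflection_matrix_inv by (auto intro: gen_group.inv)
  ultimately show ?case by metis
qed

subsection \<open>Complex reflection groups in dimension 2\<close>

lemma
  assumes "complex_reflection_group G" "g \<in> G"
  shows complex_reflection_group_invertible: "invertible g"
    and complex_reflection_group_finite_order: "\<exists>n>0. ((**) g ^^ n) (mat 1) = mat 1"
    and complex_reflection_group_reflection_word:
      "\<exists>rs. (\<forall>r\<in>set rs. r \<in> G \<and> is_reflection r) \<and> foldr (**) rs (mat 1) = g"
proof -
  obtain R where R: "\<forall>r\<in>R. is_reflection r" and G: "G = gen_group R" "finite G"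
    using assms(1) unfolding complex_reflection_group_def by blast
  have "\<forall>r\<in>R. invertible r" using R unfolding is_reflection_def by blast
  then show "invertible g" using invertible_gen_group G assms(2) by blast
  moreover have "range (\<lambda>n. ((**) g ^^ n) (mat 1)) \<subseteq> G"
    using funpow_in_gen_group G assms(2) by blast
  ultimately show "\<exists>n>0. ((**) g ^^ n) (mat 1) = mat 1"
    using finite_order_if_finite_powers finite_subset G(2) by blast
  show "\<exists>rs. (\<forall>r\<in>set rs. r \<in> G \<and> is_reflection r) \<and> foldr (**) rs (mat 1) = g"
    using gen_group_reflection_word[OF R] G assms(2) by blast
qed

lemma complex_reflection_group_matrix_inv_mult:
  "complex_reflection_group G \<Longrightarrow> c \<in> G \<Longrightarrow> g \<in> G \<Longrightarrow> matrix_inv c ** g \<in> G"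
  unfolding complex_reflection_group_def by (auto intro: gen_group.intros)

lemma complex_reflection_group_reflection_iff:
  "complex_reflection_group G \<Longrightarrow> g \<in> G \<Longrightarrow> is_reflection g \<longleftrightarrow> codim g = 1"
  using codim_reflection is_reflection_if_codim_eq_1 complex_reflection_group_invertible
    complex_reflection_group_finite_order by blast

subsection \<open>Reflection length\<close>

lemma refl_length_le:
  assumes "\<forall>r\<in>set rs. r \<in> G \<and> is_reflection r" "foldr (**) rs (mat 1) = g"
  shows "refl_length G g \<le> length rs"
  unfolding refl_length_def using assms by (intro Least_le) blast

lemma refl_length_attained:
  assumes "\<exists>rs. (\<forall>r\<in>set rs. r \<in> G \<and> is_reflection r) \<and> foldr (**) rs (mat 1) = g"
  obtains rs where "length rs = refl_length G g" "\<forall>r\<in>set rs. r \<in> G \<and> is_reflection r"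
    "foldr (**) rs (mat 1) = g"
proof -
  have "\<exists>rs. length rs = refl_length G g \<and> (\<forall>r\<in>set rs. r \<in> G \<and> is_reflection r) \<and>
      foldr (**) rs (mat 1) = g"
    unfolding refl_length_def by (rule LeastI_ex) (use assms in blast)
  then show ?thesis using that by blast
qed

lemma refl_length_mat_1: "refl_length G (mat 1) = 0"
  using refl_length_le[of "[]" G "mat 1"] by simp

lemma refl_length_gt_2_iff:
  assumes "\<exists>rs. (\<forall>r\<in>set rs. r \<in> G \<and> is_reflection r) \<and> foldr (**) rs (mat 1) = g"
    and "g \<noteq> mat 1" "\<not> is_reflection g"
  shows "2 < refl_length G g \<longleftrightarrow>
    \<not> (\<exists>r1\<in>G. \<exists>r2\<in>G. is_reflection r1 \<and> is_reflection r2 \<and> g = r1 ** r2)"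
proof
  assume "2 < refl_length G g"
  then show "\<not> (\<exists>r1\<in>G. \<exists>r2\<in>G. is_reflection r1 \<and> is_reflection r2 \<and> g = r1 ** r2)"
    using refl_length_le[of "[_, _]" G g] by fastforce
next
  assume no_product: "\<not> (\<exists>r1\<in>G. \<exists>r2\<in>G. is_reflection r1 \<and> is_reflection r2 \<and> g = r1 ** r2)"
  obtain rs where rs: "length rs = refl_length G g" "\<forall>r\<in>set rs. r \<in> G \<and> is_reflection r"
    "foldr (**) rs (mat 1) = g"
    using refl_length_attained[OF assms(1)] by blast
  have "rs \<noteq> []" "\<forall>r. rs \<noteq> [r]"
    using rs(2,3) assms(2,3) by auto
  moreover have "rs \<noteq> [r1, r2]" for r1 r2
  proof
    assume "rs = [r1, r2]"
    then have "r1 \<in> G" "r2 \<in> G" "is_reflection r1" "is_reflection r2" "g = r1 ** r2"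
      using rs(2,3) by auto
    then show False using no_product by blast
  qed
  ultimately have "2 < length rs"
    by (cases rs rule: remdups_adj.cases) auto
  then show "2 < refl_length G g" using rs(1) by simp
qed

subsection \<open>Codimension atoms\<close>

lemma codim_atom_iff:
  "codim_atom G g \<longleftrightarrow> g \<in> G \<and> g \<noteq> mat 1 \<and> \<not> (\<exists>c\<in>G. c \<noteq> mat 1 \<and> c \<noteq> g \<and> codim_le c g)"
  unfolding codim_atom_def using codim_le_mat_1 by blast

lemma codim_atom_if_codim_eq_1:
  assumes "\<forall>c\<in>G. invertible c" "g \<in> G" "codim g = 1"
  shows "codim_atom G g"
proof -
  have "g \<noteq> mat 1" using assms(3) by auto
  moreover have "\<not> codim_le c g" if "c \<in> G" "c \<noteq> mat 1" "c \<noteq> g" for c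
    using codim_le_proper(3) assms that by fastforce
  ultimately show ?thesis unfolding codim_atom_iff using assms(2) by blast
qed

lemma codim_atom_iff_not_product_of_two_reflections:
  assumes "complex_reflection_group G" "g \<in> G" "codim g = 2"
  shows "codim_atom G g \<longleftrightarrow>
    \<not> (\<exists>r1\<in>G. \<exists>r2\<in>G. is_reflection r1 \<and> is_reflection r2 \<and> g = r1 ** r2)"
proof
  assume atom: "codim_atom G g"
  show "\<not> (\<exists>r1\<in>G. \<exists>r2\<in>G. is_reflection r1 \<and> is_reflection r2 \<and> g = r1 ** r2)"
  proof
    assume "\<exists>r1\<in>G. \<exists>r2\<in>G. is_reflection r1 \<and> is_reflection r2 \<and> g = r1 ** r2"
    then obtain r1 r2 where r: "r1 \<in> G" "is_reflection r1" "is_reflection r2" "g = r1 ** r2"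
      by blast
    then have "invertible r1" unfolding is_reflection_def by blast
    then have "matrix_inv r1 ** g = r2"
      using matrix_inv_matrix_mul[of r1] r(4) by (metis matrix_mul_assoc matrix_mul_lid)
    then have "codim_le r1 g"
      unfolding codim_le_def using assms(3) r(2,3) codim_reflection by simp
    moreover have "r1 \<noteq> mat 1" using r(2) unfolding is_reflection_def by blast
    moreover have "r1 \<noteq> g" using r(2) assms(3) codim_reflection by force
    ultimately show False using atom r(1) unfolding codim_atom_iff by blast
  qed
next
  assume no_product: "\<not> (\<exists>r1\<in>G. \<exists>r2\<in>G. is_reflection r1 \<and> is_reflection r2 \<and> g = r1 ** r2)"
  have "\<not> codim_le c g" if c: "c \<in> G" "c \<noteq> mat 1" "c \<noteq> g" for c
  proof
    assume "codim_le c g"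
    note codim_one = codim_le_proper(1,2)[OF complex_reflection_group_invertible[OF assms(1) c(1)]
        c(2,3) this]
    have "matrix_inv c ** g \<in> G"
      using complex_reflection_group_matrix_inv_mult assms(1,2) c(1) by blast
    then have "is_reflection c" "is_reflection (matrix_inv c ** g)"
      using complex_reflection_group_reflection_iff[OF assms(1)] c(1) codim_one by auto
    moreover have "g = c ** (matrix_inv c ** g)"
      using matrix_mul_matrix_inv_cancel_left complex_reflection_group_invertible assms(1) c(1)
      by metis
    ultimately show False using no_product c(1) \<open>matrix_inv c ** g \<in> G\<close> by blast
  qed
  then show "codim_atom G g"
    unfolding codim_atom_iff using assms(2,3) codim_eq_0_iff by fastforce
qed

theorem mainTheorem10:
  assumes "complex_reflection_group G"
  shows "\<forall>g\<in>G. codim_atom G g \<longleftrightarrow> (is_reflection g \<or> refl_length G g > codim g)"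
proof
  fix g assume g: "g \<in> G"
  consider "codim g = 0" | "codim g = 1" | "codim g = 2"
    using codim_le_2[of g] by linarith
  then show "codim_atom G g \<longleftrightarrow> (is_reflection g \<or> refl_length G g > codim g)"
  proof cases
    case 1
    then show ?thesis
      by (simp add: codim_eq_0_iff codim_atom_def refl_length_mat_1 is_reflection_def)
  next
    case 2
    then show ?thesis
      using codim_atom_if_codim_eq_1 complex_reflection_group_invertible
        complex_reflection_group_reflection_iff assms g by blast
  next
    case 3
    then have "g \<noteq> mat 1" "\<not> is_reflection g" using codim_eq_0_iff codim_reflection by auto
    then show ?thesis
      using 3 codim_atom_iff_not_product_of_two_reflections refl_length_gt_2_iff
        complex_reflection_group_reflection_word assms g by simp
  qed
qed

end
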